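(* Let $(h_k)_{k\ge 1}$ be an increasing infinite sequence of positive integers, let $J\in\mathbb{Z}_{\ge 1}$, and let $\gamma=[f_0;f_1,f_2,\ldots]$ be an infinite simple continued fraction with convergents $E_k/F_k$ satisfying $$E_{J-2}\,F_{h_kJ-1}=F_{J-1}\,E_{h_kJ-2}\qquad\text{for all }k\in\mathbb{Z}_{\ge 1}.$$ Let $M,N\ge -1$ be integers, not both equal to $-1$, and let $\alpha=[b_0;b_1,\ldots,b_M,\gamma]=[b_0;b_1,\ldots,b_M,f_0,f_1,\ldots]$ and $\beta=[d_0;d_1,\ldots,d_N,\gamma]=[d_0;d_1,\ldots,d_N,f_0,f_1,\ldots]$ be infinite simple continued fractions with convergents $A_m/B_m$ and $C_n/D_n$, respectively. Put $$c_1:=(F_{J-1}D_{N-1}+E_{J-2}D_N)^2,\qquad c_2:=(F_{J-1}B_{M-1}+E_{J-2}B_M)^2.$$ Then for all $k\in\mathbb{Z}_{\ge 1}$ the two expressions $$q_{h_k}:=F_{J-1}B_{M-1}D_{N+h_kJ-1}+E_{J-2}B_MD_{N+h_kJ}=F_{J-1}D_{N-1}B_{M+h_kJ-1}+E_{J-2}D_NB_{M+h_kJ}$$ coincide, and $$\|q_{h_k}\alpha\|\le\frac{c_1}{q_{h_k}},\qquad \|q_{h_k}\beta\|\le\frac{c_2}{q_{h_k}}$$ hold simultaneously.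
   Context: For real $x$, $\|x\|:=\min_{k\in\mathbb{Z}}|x-k|$ is the distance to the nearest integer. A simple continued fraction $[b_0;b_1,b_2,\ldots]$ has $b_0\in\mathbb{Z}$ and $b_n\in\mathbb{Z}_{\ge1}$ for $n\ge1$; an irrational number is identified with its infinite simple continued fraction. Its convergents $A_n/B_n=[b_0;b_1,\ldots,b_n]$ are given by $A_n=b_nA_{n-1}+A_{n-2}$, $B_n=b_nB_{n-1}+B_{n-2}$ $(n\ge 0)$ with $A_{-1}=1$, $B_{-1}=0$, $A_{-2}=0$, $B_{-2}=1$. The same recurrences and initial conventions (at indices $-1,-2$) define $C_n,D_n$ from the partial quotients of $\beta$ and $E_k,F_k$ from those of $\gamma$. Conventions: $M=-1$ means $\alpha=\gamma$ and $N=-1$ means $\beta=\gamma$. Since $\alpha$ and $\beta$ are simple continued fractions, $f_0\ge1$ whenever $M\ge0$ or $N\ge0$. *)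

theory Defs
  imports "HOL-Analysis.Analysis"
begin

definition dist_nearest_int :: "real \<Rightarrow> real" where
  "dist_nearest_int x = (INF k::int. \<bar>x - of_int k\<bar>)"

(* The infimum over the integers is attained, so it is the minimum. *)
lemma dist_nearest_int_attained:
  shows "\<exists>k::int. dist_nearest_int x = \<bar>x - of_int k\<bar>"
    and "dist_nearest_int x \<le> \<bar>x - of_int k\<bar>"
proof -
  have bdd: "bdd_below (range (\<lambda>k::int. \<bar>x - of_int k\<bar>))"
    by (rule bdd_belowI[where m = 0]) auto
  then show le: "dist_nearest_int x \<le> \<bar>x - of_int k\<bar>" for k
    unfolding dist_nearest_int_def by (intro cINF_lower) auto
  have "\<bar>x - of_int (round x)\<bar> \<le> dist_nearest_int x"
    unfolding dist_nearest_int_def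
    by (intro cINF_greatest) (auto intro: round_diff_minimal)
  with le[of "round x"] show "\<exists>k::int. dist_nearest_int x = \<bar>x - of_int k\<bar>"
    by (intro exI[of _ "round x"]) linarith
qed

definition simple_cf :: "(nat \<Rightarrow> int) \<Rightarrow> bool" where
  "simple_cf b \<longleftrightarrow> (\<forall>n\<ge>1. b n \<ge> 1)"

fun finite_cf :: "(nat \<Rightarrow> int) \<Rightarrow> nat \<Rightarrow> real" where
  "finite_cf b 0 = of_int (b 0)"
| "finite_cf b (Suc n) = of_int (b 0) + 1 / finite_cf (\<lambda>i. b (Suc i)) n"

definition has_simple_cf :: "real \<Rightarrow> (nat \<Rightarrow> int) \<Rightarrow> bool" where
  "has_simple_cf x b \<longleftrightarrow> simple_cf b \<and> (\<lambda>n. finite_cf b n) \<longlonglongrightarrow> x"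

fun cf_rec :: "int \<Rightarrow> int \<Rightarrow> (nat \<Rightarrow> int) \<Rightarrow> nat \<Rightarrow> int" where
  "cf_rec u v b 0 = u"
| "cf_rec u v b (Suc 0) = v"
| "cf_rec u v b (Suc (Suc n)) = b n * cf_rec u v b (Suc n) + cf_rec u v b n"

(* Convergents are indexed by integers n \<ge> -2, stored at position n + 2.
   Values at n < -2 are irrelevant. *)
definition cf_num :: "(nat \<Rightarrow> int) \<Rightarrow> int \<Rightarrow> int" where
  "cf_num b n = cf_rec 0 1 b (nat (n + 2))"

definition cf_den :: "(nat \<Rightarrow> int) \<Rightarrow> int \<Rightarrow> int" where
  "cf_den b n = cf_rec 1 0 b (nat (n + 2))"

lemma cf_num_initial: "cf_num b (-2) = 0" "cf_num b (-1) = 1"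
  and cf_den_initial: "cf_den b (-2) = 1" "cf_den b (-1) = 0"
  by (simp_all add: cf_num_def cf_den_def)

lemma
  assumes "n \<ge> 0"
  shows cf_num_step: "cf_num b n = b (nat n) * cf_num b (n - 1) + cf_num b (n - 2)"
    and cf_den_step: "cf_den b n = b (nat n) * cf_den b (n - 1) + cf_den b (n - 2)"
proof -
  have "nat (n + 2) = Suc (Suc (nat n))" "nat (n - 1 + 2) = Suc (nat n)"
    "nat (n - 2 + 2) = nat n"
    using assms by linarith+
  then show "cf_num b n = b (nat n) * cf_num b (n - 1) + cf_num b (n - 2)"
    and "cf_den b n = b (nat n) * cf_den b (n - 1) + cf_den b (n - 2)"
    by (simp_all only: cf_num_def cf_den_def cf_rec.simps)
qed

lemma cf_rec_shift:
  "cf_rec 0 1 b (Suc (Suc n)) =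
     b 0 * cf_rec 0 1 (\<lambda>i. b (Suc i)) (Suc n) + cf_rec 1 0 (\<lambda>i. b (Suc i)) (Suc n)"
  "cf_rec 1 0 b (Suc (Suc n)) = cf_rec 0 1 (\<lambda>i. b (Suc i)) (Suc n)"
  by (induction n rule: induct_nat_012) (simp_all add: algebra_simps)

lemma cf_rec_pos:
  assumes "\<forall>i. b i \<ge> 1"
  shows "cf_rec 0 1 b (Suc n) \<ge> 1"
  using assms
proof (induction n rule: induct_nat_012)
  case (ge2 n)
  then have "b (Suc n) \<ge> 1" "cf_rec 0 1 b (Suc n) \<ge> 1" "cf_rec 0 1 b (Suc (Suc n)) \<ge> 1"
    by blast+
  moreover from this have "b (Suc n) * cf_rec 0 1 b (Suc (Suc n)) > 0"
    by (intro mult_pos_pos) linarith+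
  ultimately show ?case
    unfolding cf_rec.simps(3)[of 0 1 b "Suc n"] by linarith
qed auto

lemma finite_cf_eq_convergent:
  assumes "simple_cf b"
  shows "finite_cf b n = of_int (cf_num b (int n)) / of_int (cf_den b (int n))"
proof -
  have "finite_cf b n = of_int (cf_rec 0 1 b (Suc (Suc n))) / of_int (cf_rec 1 0 b (Suc (Suc n)))"
    using assms
  proof (induction n arbitrary: b)
    case (Suc n)
    let ?c = "\<lambda>i. b (Suc i)"
    have c: "\<forall>i. ?c i \<ge> 1" using Suc.prems by (simp add: simple_cf_def)
    then have "simple_cf ?c" by (simp add: simple_cf_def)
    note IH = Suc.IH[OF this]
    have "real_of_int (cf_rec 0 1 ?c (Suc (Suc n))) \<noteq> 0"
      using cf_rec_pos[OF c, of "Suc n"] by linarith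
    then show ?case
      by (simp add: IH cf_rec_shift[of b] add_divide_distrib del: cf_rec.simps)
  qed simp
  then show ?thesis
    by (simp add: cf_num_def cf_den_def nat_add_distrib del: cf_rec.simps)
qed

end

theory Submission
  imports Defs
begin

text \<open>
  Splitting a continued fraction after its preperiod gives
  $D_{N+1+j} = D_N E_j + D_{N-1} F_j$ (and likewise for $B$), so the two expressions for $q_{h_k}$
  differ by a multiple of $E_{J-2} F_{h_kJ-1} - F_{J-1} E_{h_kJ-2} = 0$. Each of them has the form
  $q = x B_{n-1} + y B_n$ with $x, y \ge 0$; since $|B_m \alpha - A_m| \le 1 / B_{m+1}$, the integer
  $p = x A_{n-1} + y A_n$ satisfies $|q \alpha - p| \le (x + y) / B_n$, while $q \le (x + y) B_n$.
\<close>

section \<open>Two-step linear recurrences and splitting off a preperiod\<close>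

text \<open>Solutions of one recurrence are closed under differences, so this also serves to compare
  two solutions by their initial values.\<close>

lemma two_step_rec_nonneg:
  fixes x c :: "nat \<Rightarrow> int"
  assumes "\<And>i. x (Suc (Suc i)) = c i * x (Suc i) + x i"
    and "\<And>i. c i \<ge> 0" "x 0 \<ge> 0" "x 1 \<ge> 0"
  shows "x i \<ge> 0"
  by (induction i rule: induct_nat_012) (use assms in auto)

text \<open>As functions of \<open>j\<close>, both sides solve the recurrence with coefficients
  \<open>f\<close>. The initial pairs (0, 1) and (1, 0) form a basis, and both sides agree at
  \<open>j = 0\<close> and \<open>j = 1\<close>.\<close>

lemma cf_rec_append:
  assumes "\<And>i. b (m + i) = f i"
  shows "cf_rec u v b (m + j) =
    cf_rec u v b (Suc m) * cf_rec 0 1 f j + cf_rec u v b m * cf_rec 1 0 f j"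
proof (induction j rule: induct_nat_012)
  case (ge2 j)
  then show ?case
    using assms[of j] by (simp add: algebra_simps)
qed auto

text \<open>Index \<open>M - 1\<close> is stored at position \<open>M + 1\<close>, which is also
  where \<open>b\<close> starts to agree with \<open>f\<close>. An empty preperiod is the case
  \<open>M = -1\<close>.\<close>

lemma cf_den_append:
  assumes tail: "\<And>n. b (nat (M + 1) + n) = f n" and "M \<ge> -1" "j \<ge> -2"
  shows "cf_den b (M + 1 + j) = cf_den b M * cf_num f j + cf_den b (M - 1) * cf_den f j"
proof -
  have "nat (M + 1 + j + 2) = nat (M + 1) + nat (j + 2)" "nat (M + 2) = Suc (nat (M + 1))"
    "nat (M - 1 + 2) = nat (M + 1)"
    using assms(2,3) by linarith+
  then show ?thesis
    using cf_rec_append[where b = b and f = f and m = "nat (M + 1)" and j = "nat (j + 2)", OF tail]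
    unfolding cf_den_def cf_num_def by metis
qed

section \<open>Sign and growth of numerators and denominators\<close>

lemma simple_cf_nonneg:
  assumes "simple_cf b" "n \<ge> 1"
  shows "b n \<ge> 0"
  using assms unfolding simple_cf_def by force

lemma cf_num_nonneg:
  assumes "simple_cf f" "f 0 \<ge> 1"
  shows "cf_num f n \<ge> 0"
proof -
  have "f i \<ge> 0" for i
    using assms(2) simple_cf_nonneg[OF assms(1), of i] by (cases "i = 0") auto
  then show ?thesis
    using two_step_rec_nonneg[where x = "cf_rec 0 1 f" and c = f] by (simp add: cf_num_def)
qed

lemma cf_rec_den_nonneg:
  assumes "simple_cf b"
  shows "cf_rec 1 0 b n \<ge> 0"
proof (cases n)
  case (Suc m)
  \<comment> \<open>Starting at position 1 avoids the sign of \<open>b 0\<close>: positions 1 and 2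
    hold 0 and 1 whatever its value.\<close>
  have "cf_rec 1 0 b (Suc m) \<ge> 0"
    by (rule two_step_rec_nonneg[where c = "\<lambda>i. b (Suc i)"])
      (use simple_cf_nonneg[OF assms] in auto)
  then show ?thesis using Suc by simp
qed simp

text \<open>Each partial quotient after \<open>b 0\<close> is at least 1, and the earlier term added
  is nonnegative. Position 0 is excluded because the values drop there from 1 to 0.\<close>

lemma cf_rec_den_mono:
  assumes "simple_cf b" "n \<ge> 1"
  shows "cf_rec 1 0 b n \<le> cf_rec 1 0 b (Suc n)"
proof (cases "n = 1")
  case False
  with assms(2) obtain m where m: "n = Suc (Suc m)"
    by (metis One_nat_def Suc_pred less_eq_Suc_le old.nat.exhaust)
  have "b (Suc m) \<ge> 1" using assms(1) by (simp add: simple_cf_def)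
  then have "1 * cf_rec 1 0 b n \<le> b (Suc m) * cf_rec 1 0 b n"
    by (intro mult_right_mono cf_rec_den_nonneg assms)
  then show ?thesis
    using cf_rec_den_nonneg[OF assms(1), of "Suc m"] unfolding m cf_rec.simps(3)[of 1 0 b "Suc m"]
    by linarith
qed simp

lemma cf_rec_den_pos:
  assumes "simple_cf b"
  shows "cf_rec 1 0 b (Suc (Suc n)) \<ge> 1"
proof (induction n)
  case (Suc n)
  then show ?case
    using cf_rec_den_mono[OF assms, of "Suc (Suc n)"] by linarith
qed simp

section \<open>Determinants and the approximation by convergents\<close>

lemma cf_rec_det:
  "cf_rec 1 0 b n * cf_rec 0 1 b (Suc n) - cf_rec 0 1 b n * cf_rec 1 0 b (Suc n) = (-1) ^ n"
  by (induction n) (simp_all add: algebra_simps)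

text \<open>
  With the sign $(-1)^n$, the determinant of columns $n$ and $m$ satisfies the recurrence in $m$
  with initial values $0, 1$; its product with the denominator $B_{n+1}$ is subtracted from $B_m$
  to get another nonnegative solution, with initial values $B_n, 0$.
\<close>

lemma cf_rec_cross_det_bound:
  assumes "simple_cf b" "n \<ge> 1"
  shows "cf_rec 1 0 b (Suc n) *
      \<bar>cf_rec 1 0 b n * cf_rec 0 1 b (n + j) - cf_rec 0 1 b n * cf_rec 1 0 b (n + j)\<bar>
    \<le> cf_rec 1 0 b (n + j)"
proof -
  define s where "s j = (-1) ^ n *
    (cf_rec 1 0 b n * cf_rec 0 1 b (n + j) - cf_rec 0 1 b n * cf_rec 1 0 b (n + j))" for j
  \<comment> \<open>Since \<open>n\<close> is at least 1, the possibly negative \<open>b 0\<close>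
    is not among these coefficients.\<close>
  have bn: "b (n + i) \<ge> 0" for i
    using simple_cf_nonneg[OF assms(1)] assms(2) by simp
  have s_rec: "s (Suc (Suc i)) = b (n + i) * s (Suc i) + s i" for i
    by (simp add: s_def algebra_simps)
  have s01: "s 0 = 0" "s 1 = 1"
    using cf_rec_det[of b n] by (simp_all add: s_def flip: power_add mult_2)
  have s_nonneg: "s j \<ge> 0"
    by (rule two_step_rec_nonneg[where c = "\<lambda>i. b (n + i)"]) (use s_rec bn s01 in auto)
  have "cf_rec 1 0 b (n + j) - cf_rec 1 0 b (Suc n) * s j \<ge> 0"
    by (rule two_step_rec_nonneg[where c = "\<lambda>i. b (n + i)"])
      (use s_rec bn s01 cf_rec_den_nonneg[OF assms(1), of n] in \<open>auto simp: algebra_simps\<close>)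
  moreover have
    "s j = \<bar>cf_rec 1 0 b n * cf_rec 0 1 b (n + j) - cf_rec 0 1 b n * cf_rec 1 0 b (n + j)\<bar>"
    using s_nonneg unfolding s_def by (cases "even n") auto
  ultimately show ?thesis by simp
qed

text \<open>For a finite continued fraction this is the cross determinant bound divided by the last
  denominator; being uniform in \<open>j\<close>, it passes to the limit.\<close>

lemma cf_rec_approx:
  fixes \<alpha> :: real
  assumes "has_simple_cf \<alpha> b" "n \<ge> 1"
  shows "cf_rec 1 0 b (Suc n) * \<bar>cf_rec 1 0 b n * \<alpha> - cf_rec 0 1 b n\<bar> \<le> 1"
proof -
  have b: "simple_cf b" and lim: "(\<lambda>n. finite_cf b n) \<longlonglongrightarrow> \<alpha>"
    using assms by (auto simp: has_simple_cf_def)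
  let ?B = "\<lambda>i. real_of_int (cf_rec 1 0 b i)" and ?A = "\<lambda>i. real_of_int (cf_rec 0 1 b i)"
  have "?B (Suc n) * \<bar>?B n * finite_cf b (n + j) - ?A n\<bar> \<le> 1" for j
  proof -
    \<comment> \<open>The convergent of index \<open>n + j\<close> is stored two positions
      later.\<close>
    let ?m = "n + (j + 2)"
    have "cf_rec 1 0 b ?m \<ge> 1"
      using cf_rec_den_pos[OF b, of "n + j"] by (simp only: add_2_eq_Suc' add_Suc_right)
    then have pos: "?B ?m > 0" by linarith
    have fin: "finite_cf b (n + j) = ?A ?m / ?B ?m"
      using finite_cf_eq_convergent[OF b, of "n + j"]
      by (simp add: cf_num_def cf_den_def nat_add_distrib del: cf_rec.simps)
    have "of_int (cf_rec 1 0 b (Suc n) *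
        \<bar>cf_rec 1 0 b n * cf_rec 0 1 b ?m - cf_rec 0 1 b n * cf_rec 1 0 b ?m\<bar>) \<le> ?B ?m"
      using cf_rec_cross_det_bound[OF b assms(2), of "j + 2"] by (simp only: of_int_le_iff)
    then have le: "?B (Suc n) * \<bar>?B n * ?A ?m - ?A n * ?B ?m\<bar> \<le> ?B ?m"
      by (simp del: cf_rec.simps)
    have "?B n * finite_cf b (n + j) - ?A n = (?B n * ?A ?m - ?A n * ?B ?m) / ?B ?m"
      unfolding fin using pos by (simp add: divide_simps del: cf_rec.simps)
    then have "?B (Suc n) * \<bar>?B n * finite_cf b (n + j) - ?A n\<bar>
        = ?B (Suc n) * \<bar>?B n * ?A ?m - ?A n * ?B ?m\<bar> / ?B ?m"
      using pos by (simp add: abs_divide del: cf_rec.simps)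
    also have "\<dots> \<le> 1"
      using le pos by (simp add: divide_le_eq_1 del: cf_rec.simps)
    finally show ?thesis .
  qed
  moreover have "(\<lambda>j. finite_cf b (n + j)) \<longlonglongrightarrow> \<alpha>"
    using LIMSEQ_ignore_initial_segment[OF lim, of n] by (simp add: add.commute)
  then have "(\<lambda>j. ?B (Suc n) * \<bar>?B n * finite_cf b (n + j) - ?A n\<bar>)
      \<longlonglongrightarrow> ?B (Suc n) * \<bar>?B n * \<alpha> - ?A n\<bar>"
    by (intro tendsto_intros)
  ultimately show ?thesis
    by (intro LIMSEQ_le_const2) auto
qed

section \<open>Combinations of two consecutive denominators\<close>

text \<open>Multiplying the error bound by the bound on \<open>q\<close> cancels the denominator and
  leaves \<open>(x + y)\<^sup>2\<close>, the source of both \<open>c1\<close> and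
  \<open>c2\<close>.\<close>

lemma dist_nearest_int_den_combination_le:
  assumes cf: "has_simple_cf \<alpha> b" and n: "n \<ge> 0" and x: "x \<ge> 0" and y: "y \<ge> 0"
    and q: "q = x * cf_den b (n - 1) + y * cf_den b n"
  shows "dist_nearest_int (of_int q * \<alpha>) \<le> of_int ((x + y)\<^sup>2) / of_int q"
proof -
  have b: "simple_cf b" using cf by (simp add: has_simple_cf_def)
  define i where "i = Suc (nat n)"
  have i: "nat (n - 1 + 2) = i" "nat (n + 2) = Suc i" "i \<ge> 1"
    using n by (auto simp: i_def)
  let ?B = "\<lambda>i. cf_rec 1 0 b i" and ?A = "\<lambda>i. cf_rec 0 1 b i"
  define u where "u = ?B i * \<alpha> - ?A i"
  define v where "v = ?B (Suc i) * \<alpha> - ?A (Suc i)"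
  define p where "p = x * ?A i + y * ?A (Suc i)"
  have q': "q = x * ?B i + y * ?B (Suc i)"
    using q i by (simp add: cf_den_def)
  have pos: "?B (Suc i) \<ge> 1"
    unfolding i_def by (rule cf_rec_den_pos[OF b])
  have mono: "?B i \<le> ?B (Suc i)" "?B (Suc i) \<le> ?B (Suc (Suc i))"
    using i(3) by (intro cf_rec_den_mono[OF b]; simp)+
  have u: "?B (Suc i) * \<bar>u\<bar> \<le> 1"
    unfolding u_def by (rule cf_rec_approx[OF cf i(3)])
  \<comment> \<open>The later convergent satisfies a bound with a larger denominator; it is weakened
    so that both errors carry the same factor.\<close>
  have "?B (Suc i) * \<bar>v\<bar> \<le> ?B (Suc (Suc i)) * \<bar>v\<bar>"
    by (intro mult_right_mono) (use mono in \<open>simp_all only: of_int_le_iff abs_ge_zero\<close>)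
  also have "\<dots> \<le> 1"
    unfolding v_def by (rule cf_rec_approx[OF cf]) simp
  finally have v: "?B (Suc i) * \<bar>v\<bar> \<le> 1" .
  have "?B (Suc i) * \<bar>x * u + y * v\<bar> \<le> ?B (Suc i) * (x * \<bar>u\<bar> + y * \<bar>v\<bar>)"
    using pos x y abs_triangle_ineq[of "x * u" "y * v"]
    by (intro mult_left_mono) (simp_all add: abs_mult del: cf_rec.simps)
  also have "\<dots> = x * (?B (Suc i) * \<bar>u\<bar>) + y * (?B (Suc i) * \<bar>v\<bar>)"
    by (simp only: algebra_simps)
  also have "\<dots> \<le> real_of_int x * 1 + real_of_int y * 1"
    using x y by (intro add_mono mult_left_mono u v) simp_all
  finally have uv: "?B (Suc i) * \<bar>x * u + y * v\<bar> \<le> real_of_int (x + y)" by simp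
  have "x * ?B i \<le> x * ?B (Suc i)"
    using x mono by (intro mult_left_mono) auto
  then have "q \<le> (x + y) * ?B (Suc i)"
    unfolding q' by (simp only: distrib_right)
  then have "real_of_int q \<le> of_int ((x + y) * ?B (Suc i))"
    by (simp only: of_int_le_iff)
  then have q_le: "real_of_int q \<le> real_of_int (x + y) * ?B (Suc i)"
    by (simp only: of_int_mult)
  have q_nonneg: "q \<ge> 0"
    unfolding q' using x y cf_rec_den_nonneg[OF b] by (intro add_nonneg_nonneg mult_nonneg_nonneg)
  have "q * \<alpha> - p = x * u + y * v"
    unfolding q' p_def u_def v_def of_int_add of_int_mult by (simp only: algebra_simps)
  then have dist: "dist_nearest_int (q * \<alpha>) \<le> \<bar>x * u + y * v\<bar>"
    using dist_nearest_int_attained(2)[of "q * \<alpha>" p] by simp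
  show ?thesis
  proof (cases "q = 0")
    case True
    \<comment> \<open>Division by zero makes the right side 0, and 0 is itself an integer.\<close>
    then show ?thesis using dist_nearest_int_attained(2)[of 0 0] by simp
  next
    case False
    then have "q > 0" using q_nonneg by simp
    have "q * \<bar>x * u + y * v\<bar> \<le> real_of_int (x + y) * ?B (Suc i) * \<bar>x * u + y * v\<bar>"
      by (intro mult_right_mono q_le) simp
    also have "\<dots> = real_of_int (x + y) * (?B (Suc i) * \<bar>x * u + y * v\<bar>)"
      by (simp only: mult.assoc)
    also have "\<dots> \<le> real_of_int (x + y) * real_of_int (x + y)"
      using x y by (intro mult_left_mono uv) simp
    also have "\<dots> = of_int ((x + y)\<^sup>2)"
      by (simp add: power2_eq_square)
    finally have "\<bar>x * u + y * v\<bar> \<le> of_int ((x + y)\<^sup>2) / of_int q"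
      using \<open>q > 0\<close> by (simp add: pos_le_divide_eq mult.commute)
    then show ?thesis using dist by linarith
  qed
qed

section \<open>Equality of the two expressions and simultaneous approximation\<close>

theorem theorem7:
  fixes h q :: "nat \<Rightarrow> int" and J M N c1 c2 :: int
    and f b d :: "nat \<Rightarrow> int" and \<alpha> \<beta> \<gamma> :: real
  assumes h_pos: "\<And>k. k \<ge> 1 \<Longrightarrow> h k \<ge> 1"
    and h_incr: "strict_mono_on {1..} h"
    and J: "J \<ge> 1"
    and gamma: "has_simple_cf \<gamma> f"
    and sym: "\<And>k. k \<ge> 1 \<Longrightarrow>
      cf_num f (J - 2) * cf_den f (h k * J - 1) = cf_den f (J - 1) * cf_num f (h k * J - 2)"
    and M: "M \<ge> -1" and N: "N \<ge> -1" and MN: "\<not> (M = -1 \<and> N = -1)"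
    and alpha: "has_simple_cf \<alpha> b" and alpha_tail: "\<And>n. b (nat (M + 1) + n) = f n"
    and beta: "has_simple_cf \<beta> d" and beta_tail: "\<And>n. d (nat (N + 1) + n) = f n"
    and c1: "c1 = (cf_den f (J - 1) * cf_den d (N - 1) + cf_num f (J - 2) * cf_den d N)\<^sup>2"
    and c2: "c2 = (cf_den f (J - 1) * cf_den b (M - 1) + cf_num f (J - 2) * cf_den b M)\<^sup>2"
    and q: "\<And>k. k \<ge> 1 \<Longrightarrow> q k =
      cf_den f (J - 1) * cf_den b (M - 1) * cf_den d (N + h k * J - 1)
      + cf_num f (J - 2) * cf_den b M * cf_den d (N + h k * J)"
  shows "\<forall>k\<ge>1.
      q k = cf_den f (J - 1) * cf_den d (N - 1) * cf_den b (M + h k * J - 1)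
            + cf_num f (J - 2) * cf_den d N * cf_den b (M + h k * J)
    \<and> dist_nearest_int (of_int (q k) * \<alpha>) \<le> of_int c1 / of_int (q k)
    \<and> dist_nearest_int (of_int (q k) * \<beta>) \<le> of_int c2 / of_int (q k)"
proof (intro allI impI)
  fix k :: nat
  assume k: "k \<ge> 1"
  define H where "H = h k * J"
  define e where "e = cf_num f (J - 2)"
  define g where "g = cf_den f (J - 1)"
  have "h k * J \<ge> 1 * 1"
    using h_pos[OF k] J by (intro mult_mono) auto
  \<comment> \<open>This makes \<open>M + H\<close> and \<open>N + H\<close> nonnegative, as the
    bound for combinations requires.\<close>
  then have H: "H \<ge> 1" by (simp add: H_def)
  have scf: "simple_cf f" "simple_cf b" "simple_cf d"
    using gamma alpha beta by (auto simp: has_simple_cf_def)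
  have den_nonneg: "cf_den b i \<ge> 0" "cf_den d i \<ge> 0" "cf_den f i \<ge> 0" for i
    unfolding cf_den_def by (intro cf_rec_den_nonneg scf)+
  \<comment> \<open>One preperiod is nonempty, so \<open>f 0\<close> occurs in \<open>b\<close> or
    \<open>d\<close> at an index of at least 1.\<close>
  have "f 0 \<ge> 1"
  proof (cases "M = -1")
    case True
    then have "nat (N + 1) \<ge> 1" using MN N by linarith
    then show ?thesis using scf(3) beta_tail[of 0] unfolding simple_cf_def by (metis add_0_right)
  next
    case False
    then have "nat (M + 1) \<ge> 1" using M by linarith
    then show ?thesis using scf(2) alpha_tail[of 0] unfolding simple_cf_def by (metis add_0_right)
  qed
  then have e: "e \<ge> 0" unfolding e_def by (intro cf_num_nonneg scf)
  have g: "g \<ge> 0" unfolding g_def by (rule den_nonneg)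
  have B: "cf_den b (M + H) = cf_den b M * cf_num f (H - 1) + cf_den b (M - 1) * cf_den f (H - 1)"
    "cf_den b (M + H - 1) = cf_den b M * cf_num f (H - 2) + cf_den b (M - 1) * cf_den f (H - 2)"
    using cf_den_append[where b = b and f = f and M = M and j = "H - 1", OF alpha_tail M]
      cf_den_append[where b = b and f = f and M = M and j = "H - 2", OF alpha_tail M] H
    by (simp_all add: algebra_simps)
  have D: "cf_den d (N + H) = cf_den d N * cf_num f (H - 1) + cf_den d (N - 1) * cf_den f (H - 1)"
    "cf_den d (N + H - 1) = cf_den d N * cf_num f (H - 2) + cf_den d (N - 1) * cf_den f (H - 2)"
    using cf_den_append[where b = d and f = f and M = N and j = "H - 1", OF beta_tail N]
      cf_den_append[where b = d and f = f and M = N and j = "H - 2", OF beta_tail N] H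
    by (simp_all add: algebra_simps)
  have q\<beta>: "q k = g * cf_den b (M - 1) * cf_den d (N + H - 1) + e * cf_den b M * cf_den d (N + H)"
    using q[OF k] by (simp add: e_def g_def H_def)
  \<comment> \<open>The terms in \<open>cf_den f (H - 2)\<close> and \<open>cf_num f (H - 1)\<close>
    are common to both expressions and cancel; the hypothesis on \<open>f\<close> kills the last
    factor.\<close>
  have "q k - (g * cf_den d (N - 1) * cf_den b (M + H - 1) + e * cf_den d N * cf_den b (M + H))
    = (cf_den b (M - 1) * cf_den d N - cf_den d (N - 1) * cf_den b M)
      * (g * cf_num f (H - 2) - e * cf_den f (H - 1))"
    unfolding q\<beta> B D by (simp only: algebra_simps)
  also have "\<dots> = 0"
    using sym[OF k] by (simp add: e_def g_def H_def)
  finally have q\<alpha>: "q k = g * cf_den d (N - 1) * cf_den b (M + H - 1)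
      + e * cf_den d N * cf_den b (M + H)"
    by simp
  \<comment> \<open>Here \<open>x = g * cf_den d (N - 1)\<close> and
    \<open>y = e * cf_den d N\<close>, so the square of \<open>x + y\<close> is \<open>c1\<close>.
    For \<beta> the roles of \<open>b\<close> and \<open>d\<close> are exchanged.\<close>
  have "dist_nearest_int (q k * \<alpha>) \<le> c1 / q k"
    unfolding c1 e_def[symmetric] g_def[symmetric]
    by (rule dist_nearest_int_den_combination_le[OF alpha _ _ _ q\<alpha>])
      (use M H e g den_nonneg in auto)
  moreover have "dist_nearest_int (q k * \<beta>) \<le> c2 / q k"
    unfolding c2 e_def[symmetric] g_def[symmetric]
    by (rule dist_nearest_int_den_combination_le[OF beta _ _ _ q\<beta>])
      (use N H e g den_nonneg in auto)
  ultimately show "q k = cf_den f (J - 1) * cf_den d (N - 1) * cf_den b (M + h k * J - 1)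
            + cf_num f (J - 2) * cf_den d N * cf_den b (M + h k * J)
    \<and> dist_nearest_int (of_int (q k) * \<alpha>) \<le> of_int c1 / of_int (q k)
    \<and> dist_nearest_int (of_int (q k) * \<beta>) \<le> of_int c2 / of_int (q k)"
    using q\<alpha> by (simp add: e_def g_def H_def)
qed

end
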